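(* Let $G$ be the additive group $(\mathbb{Z},+)$ and let $E$ be $\mathbb{Z}$ with the usual ordering, regarded as a semilattice (so $a\wedge b=\min\{a,b\}$). Consider the action $\theta\colon G\to\mathrm{Aut}(E)$ defined by $\theta_n(m)=n+m$. Then $\theta$ is not locally finite, but the semidirect product $E\ast_\theta G$ is a Howson inverse semigroup.
   Context: For a left action $\theta\colon G\to\mathrm{Aut}(E)$ of a group $G$ on a meet-semilattice $(E,\wedge)$, write $g\cdot e=\theta_g(e)$. The semidirect product $E\ast_\theta G$ is the set $E\times G$ with multiplication $(e,g)(f,h)=(e\wedge(g\cdot f),gh)$ (here the group operation is addition); it is an inverse semigroup with $(e,g)^{-1}=(g^{-1}\cdot e,g^{-1})$. The action is locally finite if, for every finitely generated subgroup $H\le G$ and every $e\in E$, the orbit $H\cdot e=\{h\cdot e : h\in H\}$ is finite. An inverse semigroup $S$ is a Howson inverse semigroup if the intersection of any two finitely generated inverse subsemigroups of $S$ is finitely generated (as an inverse semigroup); an empty intersection counts as finitely generated (by the empty set). *)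

theory Defs
  imports "HOL.Hull" "HOL-Algebra.Group_Action" "HOL-Algebra.Elementary_Groups"
begin

section \<open>Actions of groups on meet-semilattices\<close>

text \<open>
  A meet-semilattice is a type of class \<^class>\<open>semilattice_inf\<close>; an action on it is a
  homomorphism from the group into its automorphism group.
\<close>

definition semilattice_action ::
  "('g, 'm) monoid_scheme \<Rightarrow> ('g \<Rightarrow> 'e::semilattice_inf \<Rightarrow> 'e) \<Rightarrow> bool" where
  "semilattice_action G \<theta> \<longleftrightarrow>
     group_action G UNIV \<theta> \<and>
     (\<forall>g\<in>carrier G. \<forall>e f. \<theta> g (inf e f) = inf (\<theta> g e) (\<theta> g f))"

definition finitely_generated_subgroup :: "('g, 'm) monoid_scheme \<Rightarrow> 'g set \<Rightarrow> bool" where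
  "finitely_generated_subgroup G H \<longleftrightarrow>
     subgroup H G \<and> (\<exists>X. finite X \<and> X \<subseteq> carrier G \<and> H = generate G X)"

definition locally_finite_action ::
  "('g, 'm) monoid_scheme \<Rightarrow> ('g \<Rightarrow> 'e \<Rightarrow> 'e) \<Rightarrow> bool" where
  "locally_finite_action G \<theta> \<longleftrightarrow>
     (\<forall>H e. finitely_generated_subgroup G H \<longrightarrow> finite (orbit (G\<lparr>carrier := H\<rparr>) \<theta> e))"


section \<open>Inverse semigroups\<close>

text \<open>A semigroup is given by a carrier set \<open>S\<close> and a binary operation \<open>m\<close>.\<close>

definition is_inverse_of :: "('a \<Rightarrow> 'a \<Rightarrow> 'a) \<Rightarrow> 'a \<Rightarrow> 'a \<Rightarrow> bool" where
  "is_inverse_of m x y \<longleftrightarrow> m (m x y) x = x \<and> m (m y x) y = y"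

locale inverse_semigroup =
  fixes S :: "'a set" and m :: "'a \<Rightarrow> 'a \<Rightarrow> 'a"
  assumes closed: "\<lbrakk>x \<in> S; y \<in> S\<rbrakk> \<Longrightarrow> m x y \<in> S"
    and assoc: "\<lbrakk>x \<in> S; y \<in> S; z \<in> S\<rbrakk> \<Longrightarrow> m (m x y) z = m x (m y z)"
    and unique_inverse: "x \<in> S \<Longrightarrow> \<exists>!y. y \<in> S \<and> is_inverse_of m x y"

definition semigroup_inverse :: "'a set \<Rightarrow> ('a \<Rightarrow> 'a \<Rightarrow> 'a) \<Rightarrow> 'a \<Rightarrow> 'a" where
  "semigroup_inverse S m x = (THE y. y \<in> S \<and> is_inverse_of m x y)"

text \<open>The empty set is admitted, so that it is generated by the empty set.\<close>

definition inverse_subsemigroup :: "'a set \<Rightarrow> ('a \<Rightarrow> 'a \<Rightarrow> 'a) \<Rightarrow> 'a set \<Rightarrow> bool" where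
  "inverse_subsemigroup S m T \<longleftrightarrow>
     T \<subseteq> S \<and> (\<forall>x\<in>T. \<forall>y\<in>T. m x y \<in> T) \<and> (\<forall>x\<in>T. semigroup_inverse S m x \<in> T)"

definition finitely_generated_inverse_subsemigroup ::
  "'a set \<Rightarrow> ('a \<Rightarrow> 'a \<Rightarrow> 'a) \<Rightarrow> 'a set \<Rightarrow> bool" where
  "finitely_generated_inverse_subsemigroup S m T \<longleftrightarrow>
     inverse_subsemigroup S m T \<and>
     (\<exists>X. finite X \<and> X \<subseteq> S \<and> T = inverse_subsemigroup S m hull X)"

definition howson_inverse_semigroup :: "'a set \<Rightarrow> ('a \<Rightarrow> 'a \<Rightarrow> 'a) \<Rightarrow> bool" where
  "howson_inverse_semigroup S m \<longleftrightarrow>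
     inverse_semigroup S m \<and>
     (\<forall>A B. finitely_generated_inverse_subsemigroup S m A \<longrightarrow>
            finitely_generated_inverse_subsemigroup S m B \<longrightarrow>
            finitely_generated_inverse_subsemigroup S m (A \<inter> B))"


section \<open>Semidirect products\<close>

definition semidirect_carrier :: "('g, 'm) monoid_scheme \<Rightarrow> ('e::semilattice_inf \<times> 'g) set" where
  "semidirect_carrier G = UNIV \<times> carrier G"

definition semidirect_mult ::
  "('g, 'm) monoid_scheme \<Rightarrow> ('g \<Rightarrow> 'e::semilattice_inf \<Rightarrow> 'e) \<Rightarrow> 'e \<times> 'g \<Rightarrow> 'e \<times> 'g \<Rightarrow> 'e \<times> 'g" where
  "semidirect_mult G \<theta> = (\<lambda>(e, g) (f, h). (inf e (\<theta> g f), g \<otimes>\<^bsub>G\<^esub> h))"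

end

theory Submission
  imports Defs
begin

text \<open>
  The element \<open>(e, g)\<close> acts as the translation by \<open>g\<close> of the down-ray below \<open>e - g\<close> onto the one
  below \<open>e\<close>. If an inverse subsemigroup contains \<open>(e, p)\<close> with \<open>p > 0\<close>, then it also contains
  \<open>(f, p)\<close> for each of its idempotents \<open>(f, 0)\<close> with \<open>f \<le> e\<close>, so below \<open>e\<close> its idempotents are
  closed under subtracting \<open>p\<close>. Hence finitely many idempotents reach all others by multiples of
  \<open>p\<close>, provided that the idempotents are bounded above, and such a subsemigroup is finitely
  generated. An infinite intersection of two finitely generated subsemigroups is of this kind:
  an idempotent \<open>f\<close> far below lies in both, and if these contain shifts by \<open>p\<close> and \<open>q\<close>,
  then both contain \<open>(f, p * q)\<close>.
\<close>

text \<open>This is \<open>semidirect_mult\<close> for the action by addition, with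
  \<open>inf\<close> written as \<open>min\<close>. It composes partial translations, right factor
  first: \<open>min\<close> cuts the range down to where both are defined.\<close>

definition ray_mult :: "int \<times> int \<Rightarrow> int \<times> int \<Rightarrow> int \<times> int" where
  "ray_mult = (\<lambda>(e, g) (f, h). (min e (g + f), g + h))"

lemma ray_mult_simp [simp]: "ray_mult (e, g) (f, h) = (min e (g + f), g + h)"
  by (simp add: ray_mult_def)

lemma is_inverse_of_ray_mult_iff:
  "is_inverse_of ray_mult (e, g) (f, h) \<longleftrightarrow> f = e - g \<and> h = - g"
  by (auto simp: is_inverse_of_def min_def split: if_splits)

lemma semigroup_inverse_ray_mult [simp]:
  "semigroup_inverse UNIV ray_mult (e, g) = (e - g, - g)"
  unfolding semigroup_inverse_def
  by (rule the_equality) (auto simp: is_inverse_of_ray_mult_iff)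

lemma inverse_semigroup_ray_mult: "inverse_semigroup UNIV ray_mult"
proof
  show "\<exists>!y. y \<in> UNIV \<and> is_inverse_of ray_mult x y" for x
    by (cases x) (auto simp: is_inverse_of_ray_mult_iff)
qed (auto simp: ray_mult_def min_def)

abbreviation ray_subsemigroup :: "(int \<times> int) set \<Rightarrow> bool" where
  "ray_subsemigroup \<equiv> inverse_subsemigroup UNIV ray_mult"

abbreviation fg_ray_subsemigroup :: "(int \<times> int) set \<Rightarrow> bool" where
  "fg_ray_subsemigroup \<equiv> finitely_generated_inverse_subsemigroup UNIV ray_mult"

section \<open>Closure rules for inverse subsemigroups\<close>

lemma ray_subsemigroup_iff:
  "ray_subsemigroup T \<longleftrightarrow>
     (\<forall>e g f h. (e, g) \<in> T \<longrightarrow> (f, h) \<in> T \<longrightarrow> (min e (g + f), g + h) \<in> T) \<and>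
     (\<forall>e g. (e, g) \<in> T \<longrightarrow> (e - g, - g) \<in> T)"
  unfolding inverse_subsemigroup_def Ball_def by simp

lemma ray_mult_mem:
  assumes "ray_subsemigroup T" "(e, g) \<in> T" "(f, h) \<in> T"
  shows "(min e (g + f), g + h) \<in> T"
  using assms unfolding ray_subsemigroup_iff by blast

lemma ray_inverse_mem:
  assumes "ray_subsemigroup T" "(e, g) \<in> T"
  shows "(e - g, - g) \<in> T"
  using assms unfolding ray_subsemigroup_iff by blast

text \<open>The range of the right factor is exactly the domain of the left one, so nothing is cut
  off.\<close>

lemma ray_compose_mem:
  assumes "ray_subsemigroup T" "(e, g) \<in> T" "(e - g, h) \<in> T"
  shows "(e, g + h) \<in> T"
  using ray_mult_mem[OF assms] by simp

lemma ray_range_idem_mem: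
  assumes "ray_subsemigroup T" "(e, g) \<in> T"
  shows "(e, 0) \<in> T"
  using ray_compose_mem[OF assms ray_inverse_mem[OF assms]] by simp

lemma ray_domain_idem_mem:
  assumes "ray_subsemigroup T" "(e, g) \<in> T"
  shows "(e - g, 0) \<in> T"
  using ray_range_idem_mem[OF assms(1) ray_inverse_mem[OF assms]] .

lemma ray_restrict_mem:
  assumes "ray_subsemigroup T" "(e, g) \<in> T" "(f, 0) \<in> T" "f \<le> e"
  shows "(f, g) \<in> T"
  using ray_mult_mem[OF assms(1,3,2)] assms(4) by simp

lemma ray_power_mem:
  assumes T: "ray_subsemigroup T" and p: "(e, p) \<in> T" "0 \<le> p"
  shows "(e, int k * p) \<in> T"
proof (induction k)
  case 0
  show ?case using ray_range_idem_mem[OF T p(1)] by simp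
next
  case (Suc k)
  \<comment> \<open>An upward shift maps the ray below \<open>e\<close> to one reaching at least
    \<open>e\<close>, so the minimum keeps the top \<open>e\<close>.\<close>
  have "0 \<le> int k * p" using p(2) by simp
  then have "min e (int k * p + e) = e" by linarith
  then show ?case using ray_mult_mem[OF T Suc p(1)] by (simp add: algebra_simps)
qed

section \<open>Consequences of finite generation\<close>

lemma fg_ray_subsemigroup_bdd_above:
  assumes "fg_ray_subsemigroup T"
  obtains M where "\<And>e g. (e, g) \<in> T \<Longrightarrow> e \<le> M"
proof -
  obtain X where X: "finite X" "T = ray_subsemigroup hull X"
    using assms unfolding finitely_generated_inverse_subsemigroup_def by blast
  define Y where "Y = fst ` X \<union> (\<lambda>(e, g). e - g) ` X"
  have fin: "finite Y" unfolding Y_def using X(1) by simp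
  \<comment> \<open>Composition and inversion never raise the tops of domain and range above a
    common bound. For empty \<open>X\<close> the value \<open>Max Y\<close> is arbitrary, but
    \<open>X \<subseteq> Q\<close> is then vacuous.\<close>
  define Q where "Q = {(e, g). e \<le> Max Y \<and> e - g \<le> Max Y}"
  have "ray_subsemigroup Q"
    unfolding ray_subsemigroup_iff Q_def by auto
  moreover have "X \<subseteq> Q"
    unfolding Q_def using fin by (force simp: Y_def intro: Max_ge)
  ultimately have "T \<subseteq> Q"
    unfolding X(2) by (simp add: hull_minimal)
  then show ?thesis
    using that[of "Max Y"] unfolding Q_def by auto
qed

lemma infinite_fg_ray_subsemigroup_shift:
  assumes "fg_ray_subsemigroup T" "infinite T"
  obtains e p where "(e, p) \<in> T" "p > 0"
proof -
  obtain X where X: "finite X" "T = ray_subsemigroup hull X" and T: "ray_subsemigroup T"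
    using assms(1) unfolding finitely_generated_inverse_subsemigroup_def by blast
  have "\<exists>(e, g) \<in> X. g \<noteq> 0"
  proof (rule ccontr)
    \<comment> \<open>Finitely many idempotents form a chain, which is already closed under products
      and inverses; they generate only a finite set.\<close>
    assume "\<not> ?thesis"
    then have "X \<subseteq> fst ` X \<times> {0}" by force
    moreover have "ray_subsemigroup (fst ` X \<times> {0})"
      unfolding ray_subsemigroup_iff by (auto simp: min_def)
    ultimately have "T \<subseteq> fst ` X \<times> {0}"
      unfolding X(2) by (simp add: hull_minimal)
    then show False
      using X(1) assms(2) by (meson finite.emptyI finite.insertI finite_SigmaI finite_imageI finite_subset)
  qed
  then obtain e g where "(e, g) \<in> X" "g \<noteq> 0" by blast
  moreover have "X \<subseteq> T" unfolding X(2) by (rule hull_subset)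
  ultimately have "(e, g) \<in> T" "(e - g, - g) \<in> T"
    using ray_inverse_mem[OF T] by auto
  then show ?thesis
    using that \<open>g \<noteq> 0\<close> by (cases "g > 0") auto
qed

section \<open>Sufficient conditions for finite generation\<close>

lemma finite_ray_subsemigroup_fg:
  assumes "ray_subsemigroup T" "finite T"
  shows "fg_ray_subsemigroup T"
proof -
  have "T = ray_subsemigroup hull T"
    using assms(1) by (simp add: hull_same)
  then show ?thesis
    unfolding finitely_generated_inverse_subsemigroup_def using assms by blast
qed

lemma ray_subsemigroup_with_shift_fg:
  assumes T: "ray_subsemigroup T"
    and bdd: "\<And>a g. (a, g) \<in> T \<Longrightarrow> a \<le> M"
    and shift: "(e, p) \<in> T" "p > 0"
  shows "fg_ray_subsemigroup T"
proof -
  define E where "E = {a. (a, 0) \<in> T}"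
  have E_range: "a \<in> E" if "(a, g) \<in> T" for a g
    using ray_range_idem_mem[OF T that] by (simp add: E_def)
  have E_domain: "a - g \<in> E" if "(a, g) \<in> T" for a g
    using ray_domain_idem_mem[OF T that] by (simp add: E_def)
  have shift_mem: "(a, p) \<in> T" if "a \<in> E" "a \<le> e" for a
    using ray_restrict_mem[OF T shift(1)] that by (simp add: E_def)
  have E_down: "a - int k * p \<in> E" if "a \<in> E" "a \<le> e" for a k
    using E_domain ray_power_mem[OF T shift_mem[OF that]] shift(2) by simp

  \<comment> \<open>\<open>R\<close> holds the idempotents from which no step up by \<open>p\<close>
    within \<open>E\<close> stays below \<open>e\<close>. Each residue class modulo \<open>p\<close>
    has at most one such root below \<open>e\<close>, and the bound \<open>M\<close> leaves finitely
    many above.\<close>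
  define R where "R = {r \<in> E. \<not> (r + p \<in> E \<and> r + p \<le> e)}"
  have "inj_on (\<lambda>r. r mod p) {r \<in> R. r \<le> e}"
  proof (rule linorder_inj_onI)
    fix r s assume "r < s" and r: "r \<in> {r \<in> R. r \<le> e}" and s: "s \<in> {r \<in> R. r \<le> e}"
    show "r mod p \<noteq> s mod p"
    proof
      assume "r mod p = s mod p"
      then obtain k where k: "s - r = p * k"
        by (metis dvdE mod_eq_dvd_iff)
      have "k > 0"
        using \<open>r < s\<close> shift(2) k by (metis diff_gt_0_iff_gt zero_less_mult_pos)
      \<comment> \<open>Descending from \<open>s\<close> by one step fewer than needed to hit
        \<open>r\<close> lands on \<open>r + p\<close>, so \<open>r\<close> is not a root.\<close>
      then have "s - int (nat (k - 1)) * p = r + p"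
        using k by (simp add: algebra_simps)
      moreover have "s - int (nat (k - 1)) * p \<le> s"
        using shift(2) by simp
      ultimately have "r + p \<in> E" "r + p \<le> e"
        using E_down[of s "nat (k - 1)"] s by (auto simp: R_def)
      then show False using r by (simp add: R_def)
    qed
  qed auto
  moreover have "(\<lambda>r. r mod p) ` {r \<in> R. r \<le> e} \<subseteq> {0..<p}"
    using shift(2) by auto
  ultimately have "finite {r \<in> R. r \<le> e}"
    by (meson finite_atLeastLessThan_int inj_on_finite)
  moreover have "{r \<in> R. r > e} \<subseteq> {e..M}"
    using bdd by (auto simp: R_def E_def)
  then have "finite {r \<in> R. r > e}"
    using finite_subset by blast
  moreover have "R = {r \<in> R. r \<le> e} \<union> {r \<in> R. r > e}" by auto
  ultimately have finR: "finite R" by (metis finite_UnI)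

  \<comment> \<open>Climb from \<open>a\<close> by steps of \<open>p\<close> as long as possible. A
    root above \<open>e\<close> is reached only by zero steps, since the shift by \<open>p\<close>
    need not be available there.\<close>
  have reach: "\<exists>r \<in> R. \<exists>k::nat. a = r - int k * p \<and> (r \<le> e \<or> k = 0)" if "a \<in> E" for a
    using that
  proof (induction "nat (e - a)" arbitrary: a rule: less_induct)
    case less
    show ?case
    proof (cases "a \<in> R")
      case True
      then show ?thesis by (intro bexI[of _ a] exI[of _ 0]) auto
    next
      case False
      then have a: "a + p \<in> E" "a + p \<le> e" using less.prems by (auto simp: R_def)
      then have "nat (e - (a + p)) < nat (e - a)" using shift(2) by simp
      from less.hyps[OF this a(1)] obtain r k
        where r: "r \<in> R" "a + p = r - int k * p" "r \<le> e \<or> k = 0" by blast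
      then have "a = r - int (Suc k) * p" "r \<le> e" using a(2) by (auto simp: algebra_simps)
      then show ?thesis using r(1) by blast
    qed
  qed

  \<comment> \<open>The generators are all elements of \<open>T\<close> joining two roots, and the
    \<open>p\<close>-shifts at roots below \<open>e\<close>. The former are finitely many because
    their two ends determine them.\<close>
  define X where "X = {(a, g). (a, g) \<in> T \<and> a \<in> R \<and> a - g \<in> R} \<union> {r \<in> R. r \<le> e} \<times> {p}"
  have "X \<subseteq> R \<times> insert p ((\<lambda>(a, b). a - b) ` (R \<times> R))"
    unfolding X_def by force
  then have finX: "finite X"
    using finR by (meson finite_SigmaI finite_imageI finite_insert finite_subset)
  have XT: "X \<subseteq> T"
    unfolding X_def using shift_mem by (auto simp: R_def)
  \<comment> \<open>Stated for arbitrary \<open>Q\<close> because it is applied both to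
    \<open>T\<close> and to a competing subsemigroup that contains \<open>X\<close>.\<close>
  have descend: "(r, int k * p) \<in> Q"
    if Q: "ray_subsemigroup Q" "X \<subseteq> Q" and r: "r \<in> R" "r \<le> e \<or> k = 0" for Q r k
  proof (cases "r \<le> e")
    case True
    then have "(r, p) \<in> Q" using r Q(2) by (auto simp: X_def)
    then show ?thesis using ray_power_mem[OF Q(1)] shift(2) by simp
  next
    case False
    have "(r, 0) \<in> X" using r(1) by (simp add: X_def R_def E_def)
    then show ?thesis using False Q(2) r(2) by auto
  qed
  have "T \<subseteq> Q" if Q: "ray_subsemigroup Q" "X \<subseteq> Q" for Q
  proof clarify
    fix a g assume ag: "(a, g) \<in> T"
    obtain r k where r: "r \<in> R" "r \<le> e \<or> k = 0" and a: "a = r - int k * p"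
      using reach[OF E_range[OF ag]] by blast
    obtain s l where s: "s \<in> R" "s \<le> e \<or> l = 0" and b: "a - g = s - int l * p"
      using reach[OF E_domain[OF ag]] by blast
    \<comment> \<open>The translations from \<open>a - g\<close> up to \<open>s\<close> and from \<open>a\<close> up to \<open>r\<close> turn \<open>(a, g)\<close>
      into one of the finitely many elements of \<open>T\<close> with both ends in \<open>R\<close>.\<close>
    have "(r, int k * p + g) \<in> T"
      using ray_compose_mem[OF T descend[OF T XT r]] ag a by simp
    moreover have "(s - int l * p, - (int l * p)) \<in> T"
      using ray_inverse_mem[OF T descend[OF T XT s]] .
    moreover have end_s: "r - (int k * p + g) = s - int l * p"
      using a b by simp
    ultimately have "(r, int k * p + g + - (int l * p)) \<in> T"
      using ray_compose_mem[OF T] by metis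
    moreover have s_eq: "r - (int k * p + g + - (int l * p)) = s"
      using end_s by simp
    ultimately have "(r, int k * p + g + - (int l * p)) \<in> Q"
      using r(1) s(1) Q(2) by (auto simp: X_def)
    \<comment> \<open>Inside \<open>Q\<close>, both translations are now undone, first at the domain
      end and then at the range end.\<close>
    then have "(r, int k * p + g + - (int l * p) + int l * p) \<in> Q"
      using ray_compose_mem[OF Q(1)] descend[OF Q s] s_eq by metis
    then have "(r, int k * p + g) \<in> Q" by simp
    moreover have "(a, - (int k * p)) \<in> Q"
      using ray_inverse_mem[OF Q(1) descend[OF Q r]] a by simp
    moreover have "a - - (int k * p) = r"
      using a by simp
    ultimately have "(a, - (int k * p) + (int k * p + g)) \<in> Q"
      using ray_compose_mem[OF Q(1)] by metis
    then show "(a, g) \<in> Q" by simp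
  qed
  then have "ray_subsemigroup hull X = T"
    using XT T by (intro hull_unique) auto
  then show ?thesis
    unfolding finitely_generated_inverse_subsemigroup_def using T finX by blast
qed

section \<open>Intersections\<close>

lemma infinite_ray_subsemigroup_low_idem:
  assumes T: "ray_subsemigroup T" and bdd: "\<And>a g. (a, g) \<in> T \<Longrightarrow> a \<le> M" and "infinite T"
  obtains f where "(f, 0) \<in> T" "f \<le> N"
proof (rule ccontr)
  assume "\<not> thesis"
  then have "f \<in> {N..M}" if "(f, 0) \<in> T" for f
    using that bdd \<open>\<And>f. \<lbrakk>(f, 0) \<in> T; f \<le> N\<rbrakk> \<Longrightarrow> thesis\<close> by force
  \<comment> \<open>Both ends of an element are idempotents of \<open>T\<close>, so confining the
    idempotents to an interval leaves finitely many elements.\<close>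
  then have "a \<in> {N..M} \<and> a - g \<in> {N..M}" if "(a, g) \<in> T" for a g
    using ray_range_idem_mem[OF T that] ray_domain_idem_mem[OF T that] by blast
  then have "T \<subseteq> {N..M} \<times> {N - M..M - N}" by fastforce
  then show False using \<open>infinite T\<close> finite_subset by blast
qed

lemma fg_ray_subsemigroup_Int:
  assumes A: "fg_ray_subsemigroup A" and B: "fg_ray_subsemigroup B"
  shows "fg_ray_subsemigroup (A \<inter> B)"
proof -
  have A': "ray_subsemigroup A" and B': "ray_subsemigroup B"
    using A B unfolding finitely_generated_inverse_subsemigroup_def by auto
  then have AB: "ray_subsemigroup (A \<inter> B)"
    unfolding ray_subsemigroup_iff by blast
  show ?thesis
  proof (cases "finite (A \<inter> B)")
    case True
    then show ?thesis using finite_ray_subsemigroup_fg AB by blast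
  next
    case False
    then have inf: "infinite A" "infinite B" by auto
    obtain M where M: "\<And>a g. (a, g) \<in> A \<Longrightarrow> a \<le> M"
      using fg_ray_subsemigroup_bdd_above[OF A] by blast
    obtain e p where p: "(e, p) \<in> A" "p > 0"
      using infinite_fg_ray_subsemigroup_shift[OF A inf(1)] by blast
    obtain d q where q: "(d, q) \<in> B" "q > 0"
      using infinite_fg_ray_subsemigroup_shift[OF B inf(2)] by blast
    obtain f where f: "(f, 0) \<in> A \<inter> B" "f \<le> min e d"
      using infinite_ray_subsemigroup_low_idem[OF AB _ False] M by blast
    have "(f, p) \<in> A" "(f, q) \<in> B"
      using ray_restrict_mem[OF A' p(1)] ray_restrict_mem[OF B' q(1)] f by auto
    \<comment> \<open>The common multiple \<open>p * q\<close> turns the separate shifts into one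
      shared by \<open>A\<close> and \<open>B\<close>.\<close>
    then have "(f, int (nat q) * p) \<in> A" "(f, int (nat p) * q) \<in> B"
      using ray_power_mem[OF A'] ray_power_mem[OF B'] p(2) q(2) by (metis less_imp_le)+
    then have "(f, p * q) \<in> A \<inter> B"
      using p(2) q(2) by (simp add: mult.commute)
    then show ?thesis
      using ray_subsemigroup_with_shift_fg[OF AB] M p(2) q(2) by (meson IntD1 mult_pos_pos)
  qed
qed

section \<open>The action by translations\<close>

lemma semilattice_action_translation: "semilattice_action integer_group (+)"
proof -
  have "bij ((+) n)" for n :: int by (rule bij_betw_byWitness[where f' = "\<lambda>m. m - n"]) auto
  then have "((+) :: int \<Rightarrow> int \<Rightarrow> int) \<in> hom integer_group (BijGroup UNIV)"
    by (simp add: hom_def BijGroup_def Bij_def compose_def fun_eq_iff add.assoc)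
  then show ?thesis
    unfolding semilattice_action_def group_action_def group_hom_def group_hom_axioms_def
    by (simp add: group_BijGroup inf_min min_add_distrib_right)
qed

text \<open>The whole group is generated by \<open>1\<close> and acts transitively on an infinite
  set.\<close>

lemma not_locally_finite_action_translation: "\<not> locally_finite_action integer_group (+)"
proof
  assume "locally_finite_action integer_group ((+) :: int \<Rightarrow> int \<Rightarrow> int)"
  moreover have "finitely_generated_subgroup integer_group UNIV"
  proof -
    have "generate integer_group {1} = UNIV"
      using group.generate_pow[OF group_integer_group, of 1] by auto
    then show ?thesis
      unfolding finitely_generated_subgroup_def
      using group.subgroup_self[OF group_integer_group] by auto
  qed
  ultimately have "finite (orbit (integer_group\<lparr>carrier := UNIV\<rparr>) (+) (0::int))"
    unfolding locally_finite_action_def by blast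
  moreover have "orbit (integer_group\<lparr>carrier := UNIV\<rparr>) (+) (0::int) = UNIV"
    by (auto simp: orbit_def)
  ultimately show False using infinite_UNIV_int by simp
qed

theorem mainTheorem5:
  fixes \<theta> :: "int \<Rightarrow> int \<Rightarrow> int"
  assumes "\<And>n m. \<theta> n m = n + m"
  shows "semilattice_action integer_group \<theta>
    \<and> \<not> locally_finite_action integer_group \<theta>
    \<and> howson_inverse_semigroup (semidirect_carrier integer_group) (semidirect_mult integer_group \<theta>)"
proof -
  have \<theta>: "\<theta> = (+)" using assms by (simp add: fun_eq_iff)
  have "semidirect_carrier integer_group = (UNIV :: (int \<times> int) set)"
    by (simp add: semidirect_carrier_def)
  moreover have "semidirect_mult integer_group (+) = ray_mult"
    by (simp add: semidirect_mult_def ray_mult_def inf_min)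
  moreover have "howson_inverse_semigroup UNIV ray_mult"
    unfolding howson_inverse_semigroup_def
    using inverse_semigroup_ray_mult fg_ray_subsemigroup_Int by blast
  ultimately show ?thesis
    using semilattice_action_translation not_locally_finite_action_translation \<theta> by simp
qed

end
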